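(* Let $\Box=[0,\Delta t]\times[0,\Delta x]$, let $H_d^+=H_d^+(\{\varphi_{[i]0},\varphi_{0[\alpha]},\pi^1_{[i]1},\pi^0_{1[\alpha]}\}_{i,\alpha})$ be a (smooth) discrete boundary Hamiltonian, and let $$R_d^\Box(\varphi_{A(\Box)},\varphi_{B(\Box)},\pi_{B(\Box)})=\sum_{i=1}^s\Delta t\,b_i\pi^1_{[i]1}\varphi_{[i]1}+\sum_{\alpha=1}^\sigma\Delta x\,\tilde b_\alpha\pi^0_{1[\alpha]}\varphi_{1[\alpha]}-H_d^+(\{\varphi_{[i]0},\varphi_{0[\alpha]},\pi^1_{[i]1},\pi^0_{1[\alpha]}\}_{i,\alpha})$$ be the generalized discrete Lagrangian. Let $G$ be a Lie group with Lie algebra $\mathfrak g$. If $R_d^\Box$ is invariant under a differentiable and vertical $G$ action on the discrete restricted dual jet bundle, then a solution of the discrete forward Hamilton's equations $$\pi^1_{[i]0}=\frac{1}{b_i\Delta t}\frac{\partial H_d^+}{\partial\varphi_{[i]0}},\quad \pi^0_{0[\alpha]}=\frac{1}{\tilde b_\alpha\Delta x}\frac{\partial H_d^+}{\partial\varphi_{0[\alpha]}},\quad \varphi_{[i]1}=\frac{1}{b_i\Delta t}\frac{\partial H_d^+}{\partial\pi^1_{[i]1}},\quad \varphi_{1[\alpha]}=\frac{1}{\tilde b_\alpha\Delta x}\frac{\partial H_d^+}{\partial\pi^0_{1[\alpha]}}$$ ($i=1,\dots,s$, $\alpha=1,\dots,\sigma$) admits a discrete analog of Noether's theorem: for every $\xi\in\mathfrak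 g$ with infinitesimal generator $\tilde\xi$, $$\sum_i\Delta t\,b_i\pi^1_{[i]1}\,i_{\tilde\xi}d\varphi_{[i]1}+\sum_\alpha\Delta x\,\tilde b_\alpha\pi^0_{1[\alpha]}\,i_{\tilde\xi}d\varphi_{1[\alpha]}-\sum_i\Delta t\,b_i\pi^1_{[i]0}\,i_{\tilde\xi}d\varphi_{[i]0}-\sum_\alpha\Delta x\,\tilde b_\alpha\pi^0_{0[\alpha]}\,i_{\tilde\xi}d\varphi_{0[\alpha]}=0.$$
   Context: $Q$ is a finite-dimensional real vector space; juxtaposition $\pi\varphi$ is the duality pairing of $Q^*$ and $Q$. Quadrature rules are fixed: nodes $c_i\in[0,1]$, weights $b_i\neq0$, $\sum_ib_i=1$ ($i=1,\dots,s$) in time; nodes $\tilde c_\alpha\in[0,1]$, weights $\tilde b_\alpha\ne0$, $\sum_\alpha\tilde b_\alpha=1$ ($\alpha=1,\dots,\sigma$) in space. The discrete restricted dual jet bundle over $\Box$ is $X_d\times Q\times(Q^* )^2$, where $X_d$ is a finite set of nodes in $\Box$ containing the boundary quadrature points; a section assigns to each node a field value $\phi\in Q$ and momenta $p^0,p^1\in Q^*$. Its boundary values are: $\varphi_{[i]0},\varphi_{[i]1}$ (field at $(c_i\Delta t,0)$, $(c_i\Delta t,\Delta x)$) with normal momenta $\pi^1_{[i]0},\pi^1_{[i]1}$ (values of $p^1$ there); $\varphi_{0[\alpha]},\varphi_{1[\alpha]}$ (field at $(0,\tilde c_\alpha\Delta x)$, $(\Delta t,\tilde c_\alpha\Delta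 x)$) with normal momenta $\pi^0_{0[\alpha]},\pi^0_{1[\alpha]}$ (values of $p^0$ there). Write $\varphi_{A(\Box)}=\{\varphi_{[i]0},\varphi_{0[\alpha]}\}$, $\varphi_{B(\Box)}=\{\varphi_{[i]1},\varphi_{1[\alpha]}\}$, $\pi_{B(\Box)}=\{\pi^1_{[i]1},\pi^0_{1[\alpha]}\}$. The discrete boundary Hamiltonian $H_d^+$ is the extremal value of $\sum_i\Delta t\,b_i\pi^1_{[i]1}\varphi_{[i]1}+\sum_\alpha\Delta x\,\tilde b_\alpha\pi^0_{1[\alpha]}\varphi_{1[\alpha]}-S_d^\Box[\phi,p]$ over sections with prescribed $\varphi_{A(\Box)}$ and $\pi_{B(\Box)}$, where $S_d^\Box$ is some discrete approximation of the action; here only its being a smooth function of its arguments matters. A $G$ action on the bundle is vertical if it covers the identity on $X_d$ (it acts on the fiber $Q\times(Q^* )^2$ over each node). It induces an action on sections, and invariance of $R_d^\Box$ means invariance of $R_d^\Box$, regarded as a function of sections through their boundary values. $\tilde\xi$ is the infinitesimal generator vector field of this action for $\xi\in\mathfrak g$, and $i_{\tilde\xi}d\varphi_{[i]1}\in Q$ etc. denotes the corresponding component of $\tilde\xi$ at the solution. *)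

theory Defs
  imports "HOL-Analysis.Analysis" "HOL-Algebra.Group_Action"
begin

section \<open>Smooth maps\<close>

text \<open>
  The distribution has no predicate for smooth maps between vector spaces. On an open subset of a
  finite-dimensional space, \<^term>\<open>k_times_differentiable_on k S f\<close> says that all iterated
  directional derivatives of order at most k exist, that those of order below k are (Frechet)
  differentiable, and that those of order k are continuous, that is, that f is of class C^k.
\<close>

primrec k_times_differentiable_on ::
  "nat \<Rightarrow> 'a::real_normed_vector set \<Rightarrow> ('a \<Rightarrow> 'b::real_normed_vector) \<Rightarrow> bool" where
  "k_times_differentiable_on 0 S f \<longleftrightarrow> continuous_on S f"
| "k_times_differentiable_on (Suc k) S f \<longleftrightarrow>
     (\<forall>x\<in>S. f differentiable (at x)) \<and>
     (\<forall>v. k_times_differentiable_on k S (\<lambda>x. frechet_derivative f (at x) v))"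

definition smooth_on ::
  "'a::real_normed_vector set \<Rightarrow> ('a \<Rightarrow> 'b::real_normed_vector) \<Rightarrow> bool" where
  "smooth_on S f \<longleftrightarrow> (\<forall>k. k_times_differentiable_on k S f)"

section \<open>Lie groups\<close>

text \<open>
  A chart is a pair of its domain and its coordinate map; the values of the coordinate map outside
  the domain are irrelevant. The model space is a normed space that is later required to be
  finite-dimensional; unlike with the class of Euclidean spaces, dimension 0 is included.
\<close>

type_synonym ('g, 'e) chart = "'g set \<times> ('g \<Rightarrow> 'e)"

abbreviation chart_dom :: "('g, 'e) chart \<Rightarrow> 'g set" where
  "chart_dom \<equiv> fst"

abbreviation chart_map :: "('g, 'e) chart \<Rightarrow> 'g \<Rightarrow> 'e" where
  "chart_map \<equiv> snd"

abbreviation chart_img :: "('g, 'e) chart \<Rightarrow> 'e set" where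
  "chart_img c \<equiv> chart_map c ` chart_dom c"

abbreviation chart_inv :: "('g, 'e) chart \<Rightarrow> 'e \<Rightarrow> 'g" where
  "chart_inv c \<equiv> inv_into (chart_dom c) (chart_map c)"

definition smooth_atlas ::
  "'g topology \<Rightarrow> ('g, 'e::real_normed_vector) chart set \<Rightarrow> bool" where
  "smooth_atlas T A \<longleftrightarrow>
     (\<Union>c\<in>A. chart_dom c) = topspace T \<and>
     (\<forall>c\<in>A. openin T (chart_dom c) \<and> open (chart_img c) \<and>
        homeomorphic_map (subtopology T (chart_dom c)) (top_of_set (chart_img c)) (chart_map c)) \<and>
     (\<forall>c\<in>A. \<forall>d\<in>A.
        smooth_on (chart_map c ` (chart_dom c \<inter> chart_dom d)) (chart_map d \<circ> chart_inv c))"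

locale lie_group = group G for G :: "('g, 'z) monoid_scheme" (structure) +
  fixes T :: "'g topology"
    and A :: "('g, 'e::real_normed_vector) chart set"
  assumes model_finite_dim: "\<exists>B::'e set. finite B \<and> span B = UNIV"
    and topspace_carrier: "topspace T = carrier G"
    and Hausdorff: "Hausdorff_space T"
    and second_countable: "second_countable T"
    and atlas: "smooth_atlas T A"
    and mult_continuous: "continuous_map (prod_topology T T) T (\<lambda>(g, h). g \<otimes> h)"
    and mult_smooth: "\<And>c d e. \<lbrakk>c \<in> A; d \<in> A; e \<in> A\<rbrakk> \<Longrightarrow>
          smooth_on {(x, y). x \<in> chart_img c \<and> y \<in> chart_img d \<and>
                             chart_inv c x \<otimes> chart_inv d y \<in> chart_dom e}
                    (\<lambda>(x, y). chart_map e (chart_inv c x \<otimes> chart_inv d y))"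
    and inv_continuous: "continuous_map T T (\<lambda>g. inv g)"
    and inv_smooth: "\<And>c d. \<lbrakk>c \<in> A; d \<in> A\<rbrakk> \<Longrightarrow>
          smooth_on {x. x \<in> chart_img c \<and> inv (chart_inv c x) \<in> chart_dom d}
                    (\<lambda>x. chart_map d (inv (chart_inv c x)))"

text \<open>
  A tangent vector at p is a family of coordinate vectors, one for each chart around p, that
  transforms with the derivatives of the chart transitions.
\<close>

definition charts_at :: "('g, 'e) chart set \<Rightarrow> 'g \<Rightarrow> ('g, 'e) chart set" where
  "charts_at A p = {c\<in>A. p \<in> chart_dom c}"

definition tangent_space ::
  "('g, 'e::real_normed_vector) chart set \<Rightarrow> 'g \<Rightarrow> (('g, 'e) chart \<Rightarrow> 'e) set" where
  "tangent_space A p = {\<xi> \<in> extensional (charts_at A p).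
     \<forall>c\<in>charts_at A p. \<forall>d\<in>charts_at A p.
       \<xi> d = frechet_derivative (chart_map d \<circ> chart_inv c) (at (chart_map c p)) (\<xi> c)}"

text \<open>
  The differential at p of a map into a normed space, applied to a tangent vector; by the
  transformation law the choice of the chart does not matter.
\<close>

definition tangent_map ::
  "('g, 'e::real_normed_vector) chart set \<Rightarrow> ('g \<Rightarrow> 'b::real_normed_vector) \<Rightarrow> 'g \<Rightarrow>
   (('g, 'e) chart \<Rightarrow> 'e) \<Rightarrow> 'b" where
  "tangent_map A f p \<xi> =
     (let c = SOME c. c \<in> charts_at A p
      in frechet_derivative (f \<circ> chart_inv c) (at (chart_map c p)) (\<xi> c))"

text \<open>
  The underlying vector space of the Lie algebra; the bracket is not needed here.
\<close>

definition lie_algebra ::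
  "('g, 'z) monoid_scheme \<Rightarrow> ('g, 'e::real_normed_vector) chart set \<Rightarrow>
   (('g, 'e) chart \<Rightarrow> 'e) set" where
  "lie_algebra G A = tangent_space A \<one>\<^bsub>G\<^esub>"

section \<open>The discrete restricted dual jet bundle over a rectangle\<close>

text \<open>
  A node is a point (t, x) of the rectangle, and an element (phi, p0, p1) of the fiber consists of a
  field value and the two momenta. The dual space is the space of bounded functionals, which
  contains all linear functionals when the space is finite-dimensional. The bundle over a finite
  set X of nodes is the trivial bundle \<^term>\<open>X \<times> UNIV\<close>. Sections are total functions of which
  only the values on X matter.
\<close>

type_synonym node = "real \<times> real"
type_synonym 'q dual = "'q \<Rightarrow>\<^sub>L real"
type_synonym 'q fiber = "'q \<times> 'q dual \<times> 'q dual"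
type_synonym 'q bsection = "node \<Rightarrow> 'q fiber"

definition field_val :: "'q::real_normed_vector fiber \<Rightarrow> 'q" where
  "field_val v = fst v"

definition mom0 :: "'q::real_normed_vector fiber \<Rightarrow> 'q dual" where
  "mom0 v = fst (snd v)"

definition mom1 :: "'q::real_normed_vector fiber \<Rightarrow> 'q dual" where
  "mom1 v = snd (snd v)"

definition quadrature_rule :: "real^'s::finite \<Rightarrow> real^'s \<Rightarrow> bool" where
  "quadrature_rule c b \<longleftrightarrow>
     (\<forall>i. 0 \<le> c $ i \<and> c $ i \<le> 1 \<and> b $ i \<noteq> 0) \<and> (\<Sum>i\<in>UNIV. b $ i) = 1"

definition time_node :: "real \<Rightarrow> real^'s::finite \<Rightarrow> real \<Rightarrow> 's \<Rightarrow> node" where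
  "time_node dt c x i = (c $ i * dt, x)"

definition space_node :: "real \<Rightarrow> real^'r::finite \<Rightarrow> real \<Rightarrow> 'r \<Rightarrow> node" where
  "space_node dx c' t \<alpha> = (t, c' $ \<alpha> * dx)"

definition admissible_nodes ::
  "real \<Rightarrow> real \<Rightarrow> real^'s::finite \<Rightarrow> real^'r::finite \<Rightarrow> node set \<Rightarrow> bool" where
  "admissible_nodes dt dx c c' X \<longleftrightarrow>
     finite X \<and> X \<subseteq> {0..dt} \<times> {0..dx} \<and>
     range (time_node dt c 0) \<union> range (time_node dt c dx) \<union>
     range (space_node dx c' 0) \<union> range (space_node dx c' dt) \<subseteq> X"

text \<open>
  The boundary values: the field at the time (space) quadrature nodes on the edge at space
  coordinate x (at time t), and the normal momenta there.
\<close>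

definition time_fields ::
  "real \<Rightarrow> real^'s::finite \<Rightarrow> 'q::real_normed_vector bsection \<Rightarrow> real \<Rightarrow> 'q^'s" where
  "time_fields dt c \<sigma> x = (\<chi> i. field_val (\<sigma> (time_node dt c x i)))"

definition time_momenta ::
  "real \<Rightarrow> real^'s::finite \<Rightarrow> 'q::real_normed_vector bsection \<Rightarrow> real \<Rightarrow> ('q dual)^'s" where
  "time_momenta dt c \<sigma> x = (\<chi> i. mom1 (\<sigma> (time_node dt c x i)))"

definition space_fields ::
  "real \<Rightarrow> real^'r::finite \<Rightarrow> 'q::real_normed_vector bsection \<Rightarrow> real \<Rightarrow> 'q^'r" where
  "space_fields dx c' \<sigma> t = (\<chi> \<alpha>. field_val (\<sigma> (space_node dx c' t \<alpha>)))"

definition space_momenta ::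
  "real \<Rightarrow> real^'r::finite \<Rightarrow> 'q::real_normed_vector bsection \<Rightarrow> real \<Rightarrow> ('q dual)^'r" where
  "space_momenta dx c' \<sigma> t = (\<chi> \<alpha>. mom0 (\<sigma> (space_node dx c' t \<alpha>)))"

section \<open>Boundary Hamiltonian, generalized Lagrangian and Hamilton's equations\<close>

text \<open>
  A boundary Hamiltonian H is a function of the field values at time nodes with x = 0 and at space
  nodes with t = 0, and of the normal momenta at time nodes with x = dx and at space nodes with
  t = dt. Every smooth such H occurs as an extremal value of K - S, where K is the sum of the
  boundary pairings: take S = K - H.
\<close>

type_synonym ('q, 's, 'r) bhamiltonian =
  "('q^'s) \<times> ('q^'r) \<times> (('q dual)^'s) \<times> (('q dual)^'r) \<Rightarrow> real"

definition generalized_lagrangian ::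
  "real \<Rightarrow> real \<Rightarrow> real^'s::finite \<Rightarrow> real^'r::finite \<Rightarrow>
   ('q::real_normed_vector, 's, 'r) bhamiltonian \<Rightarrow>
   ('q^'s) \<times> ('q^'r) \<Rightarrow> ('q^'s) \<times> ('q^'r) \<Rightarrow> (('q dual)^'s) \<times> (('q dual)^'r) \<Rightarrow> real" where
  "generalized_lagrangian dt dx b b' H = (\<lambda>(\<phi>0, \<psi>0) (\<phi>1, \<psi>1) (\<pi>1, \<rho>1).
     (\<Sum>i\<in>UNIV. dt * b $ i * blinfun_apply (\<pi>1 $ i) (\<phi>1 $ i)) +
     (\<Sum>\<alpha>\<in>UNIV. dx * b' $ \<alpha> * blinfun_apply (\<rho>1 $ \<alpha>) (\<psi>1 $ \<alpha>)) -
     H (\<phi>0, \<psi>0, \<pi>1, \<rho>1))"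

definition section_lagrangian ::
  "real \<Rightarrow> real \<Rightarrow> real^'s::finite \<Rightarrow> real^'s \<Rightarrow> real^'r::finite \<Rightarrow> real^'r \<Rightarrow>
   ('q::real_normed_vector, 's, 'r) bhamiltonian \<Rightarrow> 'q bsection \<Rightarrow> real" where
  "section_lagrangian dt dx c b c' b' H \<sigma> =
     generalized_lagrangian dt dx b b' H
       (time_fields dt c \<sigma> 0, space_fields dx c' \<sigma> 0)
       (time_fields dt c \<sigma> dx, space_fields dx c' \<sigma> dt)
       (time_momenta dt c \<sigma> dx, space_momenta dx c' \<sigma> dt)"

definition vec_upd :: "'a^'s::finite \<Rightarrow> 's \<Rightarrow> 'a \<Rightarrow> 'a^'s" where
  "vec_upd v i y = (\<chi> j. if j = i then y else v $ j)"

definition derivative_covector :: "('a::real_normed_vector \<Rightarrow> real) \<Rightarrow> 'a \<Rightarrow> 'a dual" where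
  "derivative_covector f a = Blinfun (frechet_derivative f (at a))"

text \<open>
  The canonical map into the bidual, an isomorphism in finite dimension. Its inverse turns the
  derivative of a function of a momentum into an element of the original space.
\<close>

definition to_bidual :: "'q::real_normed_vector \<Rightarrow> 'q dual dual" where
  "to_bidual q = Blinfun (\<lambda>p. blinfun_apply p q)"

definition derivative_vector :: "('q::real_normed_vector dual \<Rightarrow> real) \<Rightarrow> 'q dual \<Rightarrow> 'q" where
  "derivative_vector f p = Hilbert_Choice.inv to_bidual (derivative_covector f p)"

definition forward_hamilton_equations ::
  "real \<Rightarrow> real \<Rightarrow> real^'s::finite \<Rightarrow> real^'s \<Rightarrow> real^'r::finite \<Rightarrow> real^'r \<Rightarrow>
   ('q::real_normed_vector, 's, 'r) bhamiltonian \<Rightarrow> 'q bsection \<Rightarrow> bool" where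
  "forward_hamilton_equations dt dx c b c' b' H \<sigma> \<longleftrightarrow>
     (let \<phi>0 = time_fields dt c \<sigma> 0; \<psi>0 = space_fields dx c' \<sigma> 0;
          \<phi>1 = time_fields dt c \<sigma> dx; \<psi>1 = space_fields dx c' \<sigma> dt;
          \<pi>0 = time_momenta dt c \<sigma> 0; \<rho>0 = space_momenta dx c' \<sigma> 0;
          \<pi>1 = time_momenta dt c \<sigma> dx; \<rho>1 = space_momenta dx c' \<sigma> dt
      in
        (\<forall>i. \<pi>0 $ i = (1 / (b $ i * dt)) *\<^sub>R
               derivative_covector (\<lambda>q. H (vec_upd \<phi>0 i q, \<psi>0, \<pi>1, \<rho>1)) (\<phi>0 $ i)) \<and>
        (\<forall>\<alpha>. \<rho>0 $ \<alpha> = (1 / (b' $ \<alpha> * dx)) *\<^sub>R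
               derivative_covector (\<lambda>q. H (\<phi>0, vec_upd \<psi>0 \<alpha> q, \<pi>1, \<rho>1)) (\<psi>0 $ \<alpha>)) \<and>
        (\<forall>i. \<phi>1 $ i = (1 / (b $ i * dt)) *\<^sub>R
               derivative_vector (\<lambda>p. H (\<phi>0, \<psi>0, vec_upd \<pi>1 i p, \<rho>1)) (\<pi>1 $ i)) \<and>
        (\<forall>\<alpha>. \<psi>1 $ \<alpha> = (1 / (b' $ \<alpha> * dx)) *\<^sub>R
               derivative_vector (\<lambda>p. H (\<phi>0, \<psi>0, \<pi>1, vec_upd \<rho>1 \<alpha> p)) (\<rho>1 $ \<alpha>)))"

section \<open>Group actions on the bundle\<close>

text \<open>
  Actions are functions on the total space, for use with \<^locale>\<open>group_action\<close>.
\<close>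

type_synonym ('g, 'q) baction = "'g \<Rightarrow> node \<times> 'q fiber \<Rightarrow> node \<times> 'q fiber"

definition vertical_action ::
  "('g, 'z) monoid_scheme \<Rightarrow> node set \<Rightarrow> ('g, 'q::real_normed_vector) baction \<Rightarrow> bool" where
  "vertical_action G X \<Phi> \<longleftrightarrow> (\<forall>g\<in>carrier G. \<forall>n\<in>X. \<forall>v. fst (\<Phi> g (n, v)) = n)"

text \<open>
  Differentiability of the action map from the product of the group and the total space, for a
  vertical action. The set of nodes is discrete, so this is joint differentiability in the group
  element and the fiber variable, separately at each node.
\<close>

definition differentiable_action ::
  "('g, 'e::real_normed_vector) chart set \<Rightarrow> node set \<Rightarrow>
   ('g, 'q::real_normed_vector) baction \<Rightarrow> bool" where
  "differentiable_action A X \<Phi> \<longleftrightarrow>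
     (\<forall>n\<in>X. \<forall>c\<in>A.
        (\<lambda>(y, v). snd (\<Phi> (chart_inv c y) (n, v))) differentiable_on (chart_img c \<times> UNIV))"

definition section_action ::
  "('g, 'q::real_normed_vector) baction \<Rightarrow> 'g \<Rightarrow> 'q bsection \<Rightarrow> 'q bsection" where
  "section_action \<Phi> g \<sigma> = (\<lambda>n. snd (\<Phi> g (n, \<sigma> n)))"

definition invariant_under ::
  "('g, 'z) monoid_scheme \<Rightarrow> ('g, 'q::real_normed_vector) baction \<Rightarrow>
   ('q bsection \<Rightarrow> real) \<Rightarrow> bool" where
  "invariant_under G \<Phi> R \<longleftrightarrow> (\<forall>g\<in>carrier G. \<forall>\<sigma>. R (section_action \<Phi> g \<sigma>) = R \<sigma>)"

text \<open>
  The value at a section of the generator vector field of the action on sections: at each node, the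
  differential at the identity of the orbit map, applied to the Lie algebra element.
\<close>

definition infinitesimal_generator ::
  "('g, 'z) monoid_scheme \<Rightarrow> ('g, 'e::real_normed_vector) chart set \<Rightarrow>
   ('g, 'q::real_normed_vector) baction \<Rightarrow> (('g, 'e) chart \<Rightarrow> 'e) \<Rightarrow>
   'q bsection \<Rightarrow> 'q bsection" where
  "infinitesimal_generator G A \<Phi> \<xi> \<sigma> =
     (\<lambda>n. tangent_map A (\<lambda>g. section_action \<Phi> g \<sigma> n) \<one>\<^bsub>G\<^esub> \<xi>)"

end

theory Submission
  imports Defs
begin

text \<open>
  Invariance makes the generalized Lagrangian R constant along the curve of sections swept out by a
  chart of G around the identity, so the derivative of R at the solution in the direction of the
  infinitesimal generator vanishes. On solutions of Hamilton's equations the terms with variations of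
  the final momenta cancel in this derivative, and what is left is the Noether identity.
\<close>

lemma bounded_linear_axis: "bounded_linear (axis i :: 'a::real_normed_vector \<Rightarrow> 'a^'n::finite)"
proof (rule bounded_linear_intro[where K = 1])
  fix x y :: 'a and r :: real
  show "axis i (x + y) = (axis i x + axis i y :: 'a^'n)"
    by (simp add: axis_def vec_eq_iff)
  show "axis i (r *\<^sub>R x) = r *\<^sub>R (axis i x :: 'a^'n)"
    by (simp add: axis_def vec_eq_iff)
  have "norm (axis i x :: 'a^'n) \<le> (\<Sum>j\<in>UNIV. norm ((axis i x :: 'a^'n) $ j))"
    unfolding norm_vec_def by (rule L2_set_le_sum) simp
  also have "\<dots> = norm x"
    by (simp add: axis_def if_distrib[of norm] cong: if_cong)
  finally show "norm (axis i x :: 'a^'n) \<le> norm x * 1"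
    by simp
qed

lemma sum_axis_nth: "(\<Sum>i\<in>UNIV. axis i (v $ i)) = (v :: 'a::comm_monoid_add^'n::finite)"
  by (simp add: vec_eq_iff axis_def)

lemma has_derivative_vec_lambda:
  fixes f :: "'n::finite \<Rightarrow> 'a::real_normed_vector \<Rightarrow> 'b::real_normed_vector"
  assumes "\<And>i. (f i has_derivative f' i) F"
  shows "((\<lambda>x. \<chi> i. f i x) has_derivative (\<lambda>h. \<chi> i. f' i h)) F"
proof -
  have "((\<lambda>x. \<Sum>i\<in>UNIV. axis i (f i x)) has_derivative (\<lambda>h. \<Sum>i\<in>UNIV. axis i (f' i h))) F"
    by (intro has_derivative_sum bounded_linear.has_derivative[OF bounded_linear_axis] assms)
  then show ?thesis
    using sum_axis_nth[of "\<chi> i. f i _"] sum_axis_nth[of "\<chi> i. f' i _"] by simp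
qed

lemma has_derivative_vec_upd:
  fixes v :: "'a::real_normed_vector^'n::finite"
  shows "(vec_upd v i has_derivative axis i) (at y)"
proof -
  have "vec_upd v i = (\<lambda>y. vec_upd v i 0 + axis i y)"
    by (auto simp: vec_upd_def axis_def vec_eq_iff fun_eq_iff)
  moreover have "((\<lambda>y. vec_upd v i 0 + axis i y) has_derivative (\<lambda>h. 0 + axis i h)) (at y)"
    by (intro has_derivative_add has_derivative_const
        bounded_linear_imp_has_derivative bounded_linear_axis)
  ultimately show ?thesis by simp
qed

lemma vec_upd_nth_self: "vec_upd v i (v $ i) = v"
  by (simp add: vec_upd_def vec_eq_iff)

lemma has_derivative_vec_upd_comp:
  fixes f :: "'a::real_normed_vector^'n::finite \<Rightarrow> 'b::real_normed_vector"
  assumes "(f has_derivative f') (at v)"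
  shows "((\<lambda>y. f (vec_upd v i y)) has_derivative (\<lambda>h. f' (axis i h))) (at (v $ i))"
  by (rule has_derivative_compose[OF has_derivative_vec_upd]) (simp add: vec_upd_nth_self assms)

lemma derivative_eq_sum_partial:
  fixes f :: "'a::real_normed_vector^'n::finite \<Rightarrow> 'b::real_normed_vector"
  assumes "(f has_derivative f') (at v)"
  shows "f' u = (\<Sum>i\<in>UNIV. frechet_derivative (\<lambda>y. f (vec_upd v i y)) (at (v $ i)) (u $ i))"
proof -
  interpret f': bounded_linear f'
    by (rule has_derivative_bounded_linear[OF assms])
  have "frechet_derivative (\<lambda>y. f (vec_upd v i y)) (at (v $ i)) = (\<lambda>h. f' (axis i h))" for i
    by (rule frechet_derivative_at[symmetric]) (rule has_derivative_vec_upd_comp[OF assms])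
  then show ?thesis
    using f'.sum[of "\<lambda>i. axis i (u $ i)" UNIV] by (simp add: sum_axis_nth)
qed

lemma blinfun_apply_derivative_covector:
  assumes "f differentiable (at a)"
  shows "blinfun_apply (derivative_covector f a) = frechet_derivative f (at a)"
  unfolding derivative_covector_def
  using assms by (intro bounded_linear_Blinfun_apply)
    (metis frechet_derivative_works has_derivative_bounded_linear)

lemma linear_functional_combination:
  fixes L :: "'v::real_vector \<Rightarrow> real" and f :: "'i \<Rightarrow> 'v \<Rightarrow> real"
  assumes "finite B" and "linear L" and "\<And>e. e \<in> B \<Longrightarrow> linear (f e)"
    and "\<And>p. (\<And>e. e \<in> B \<Longrightarrow> f e p = 0) \<Longrightarrow> L p = 0"
  shows "\<exists>a. \<forall>p. L p = (\<Sum>e\<in>B. a e * f e p)"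
  using assms
proof (induction B arbitrary: L rule: finite_induct)
  case empty
  then show ?case by simp
next
  case (insert e B)
  show ?case
  proof (cases "\<forall>p. (\<forall>e'\<in>B. f e' p = 0) \<longrightarrow> f e p = 0")
    case True
    with insert.prems insert.IH[of L] obtain a where "\<forall>p. L p = (\<Sum>e\<in>B. a e * f e p)"
      by (metis insert_iff)
    then have "\<forall>p. L p = (\<Sum>e'\<in>insert e B. (a(e := 0)) e' * f e' p)"
      using insert.hyps by (auto intro!: sum.cong)
    then show ?thesis by blast
  next
    case False
    then obtain p0 where p0: "\<And>e'. e' \<in> B \<Longrightarrow> f e' p0 = 0" "f e p0 \<noteq> 0"
      by blast
    define k where "k = L p0 / f e p0"
    have lin: "linear (f e')" if "e' \<in> insert e B" for e'
      using insert.prems that by blast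
    have "L p - k * f e p = 0" if p: "\<And>e'. e' \<in> B \<Longrightarrow> f e' p = 0" for p
    proof -
      have "L (p - (f e p / f e p0) *\<^sub>R p0) = 0"
        using p p0 lin by (intro insert.prems(3)) (auto simp: linear_diff linear_scale)
      then show ?thesis
        using insert.prems(1) p0(2) by (simp add: linear_diff linear_scale k_def)
    qed
    moreover have "linear (\<lambda>p. L p - k * f e p)"
      using insert.prems(1) lin[of e]
      by (intro linear_compose_sub) (auto simp: linear_iff algebra_simps)
    ultimately obtain a where "\<forall>p. L p - k * f e p = (\<Sum>e\<in>B. a e * f e p)"
      using insert.IH[of "\<lambda>p. L p - k * f e p"] lin by (metis insert_iff)
    then have "\<forall>p. L p = k * f e p + (\<Sum>e'\<in>B. a e' * f e' p)"
      by (metis diff_eq_eq add.commute)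
    then have "\<forall>p. L p = (\<Sum>e'\<in>insert e B. (a(e := k)) e' * f e' p)"
      using insert.hyps by (auto intro!: sum.cong)
    then show ?thesis by blast
  qed
qed

lemma blinfun_apply_to_bidual: "blinfun_apply (to_bidual q) p = blinfun_apply p q"
  unfolding to_bidual_def
  by (simp add: bounded_linear_Blinfun_apply blinfun.bounded_linear_left)

lemma surj_to_bidual:
  assumes "finite B" and "span B = (UNIV :: 'q::real_normed_vector set)"
  shows "surj (to_bidual :: 'q \<Rightarrow> _)"
proof (rule surjI)
  fix L :: "'q dual dual"
  have zero: "p = 0" if "\<And>e. e \<in> B \<Longrightarrow> blinfun_apply p e = 0" for p :: "'q dual"
  proof (rule blinfun_eqI)
    fix x :: 'q
    have "x \<in> span B" using assms(2) by simp
    then show "blinfun_apply p x = blinfun_apply 0 x"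
      using that linear_eq_on[of "blinfun_apply p" "\<lambda>_. 0"]
      by (auto simp: bounded_linear.linear blinfun.bounded_linear_right linear_zero)
  qed
  have "\<exists>a. \<forall>p. blinfun_apply L p = (\<Sum>e\<in>B. a e * blinfun_apply p e)"
  proof (rule linear_functional_combination[OF assms(1)])
    show "blinfun_apply L p = 0" if "\<And>e. e \<in> B \<Longrightarrow> blinfun_apply p e = 0" for p
      using zero[OF that] by (simp add: blinfun.zero_right)
  qed (simp_all add: bounded_linear.linear blinfun.bounded_linear_right
      blinfun.bounded_linear_left)
  then obtain a where "\<And>p. blinfun_apply L p = (\<Sum>e\<in>B. a e * blinfun_apply p e)"
    by blast
  then have "to_bidual (\<Sum>e\<in>B. a e *\<^sub>R e) = L"
    by (intro blinfun_eqI)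
      (simp add: blinfun_apply_to_bidual blinfun.sum_right blinfun.scaleR_right)
  then show "to_bidual (SOME q. to_bidual q = L) = L"
    by (rule someI)
qed

lemma blinfun_apply_derivative_vector:
  assumes "\<exists>B::'q::real_normed_vector set. finite B \<and> span B = UNIV"
    and "f differentiable (at (p0 :: 'q dual))"
  shows "blinfun_apply p (derivative_vector f p0) = frechet_derivative f (at p0) p"
proof -
  have "surj (to_bidual :: 'q \<Rightarrow> _)"
    using assms(1) surj_to_bidual by blast
  then have "to_bidual (derivative_vector f p0) = derivative_covector f p0"
    unfolding derivative_vector_def by (rule surj_f_inv_f)
  then show ?thesis
    by (metis blinfun_apply_to_bidual blinfun_apply_derivative_covector assms(2))
qed

lemma derivative_boundary_hamiltonian:
  fixes H :: "('q::real_normed_vector, 's::finite, 'r::finite) bhamiltonian"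
    and c b :: "real^'s" and c' b' :: "real^'r" and dt dx :: real and \<sigma> :: "'q bsection"
  defines "\<phi>0 \<equiv> time_fields dt c \<sigma> 0" and "\<psi>0 \<equiv> space_fields dx c' \<sigma> 0"
    and "\<phi>1 \<equiv> time_fields dt c \<sigma> dx" and "\<psi>1 \<equiv> space_fields dx c' \<sigma> dt"
    and "\<pi>0 \<equiv> time_momenta dt c \<sigma> 0" and "\<rho>0 \<equiv> space_momenta dx c' \<sigma> 0"
    and "\<pi>1 \<equiv> time_momenta dt c \<sigma> dx" and "\<rho>1 \<equiv> space_momenta dx c' \<sigma> dt"
  assumes fin: "\<exists>B::'q set. finite B \<and> span B = UNIV"
    and dt: "dt \<noteq> 0" and dx: "dx \<noteq> 0" and b: "\<And>i. b $ i \<noteq> 0" and b': "\<And>\<alpha>. b' $ \<alpha> \<noteq> 0"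
    and eqs: "forward_hamilton_equations dt dx c b c' b' H \<sigma>"
    and DH: "(H has_derivative H') (at (\<phi>0, \<psi>0, \<pi>1, \<rho>1))"
  shows "H' (u, v, w, z) =
      (\<Sum>i\<in>UNIV. dt * b $ i * blinfun_apply (\<pi>0 $ i) (u $ i)) +
      (\<Sum>\<alpha>\<in>UNIV. dx * b' $ \<alpha> * blinfun_apply (\<rho>0 $ \<alpha>) (v $ \<alpha>)) +
      (\<Sum>i\<in>UNIV. dt * b $ i * blinfun_apply (w $ i) (\<phi>1 $ i)) +
      (\<Sum>\<alpha>\<in>UNIV. dx * b' $ \<alpha> * blinfun_apply (z $ \<alpha>) (\<psi>1 $ \<alpha>))"
proof -
  interpret H': bounded_linear H'
    by (rule has_derivative_bounded_linear[OF DH])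
  have D1: "((\<lambda>q. H (q, \<psi>0, \<pi>1, \<rho>1)) has_derivative (\<lambda>h. H' (h, 0, 0, 0))) (at (\<phi>0))"
    by (rule has_derivative_compose[where g = H and g' = H'])
      (intro has_derivative_Pair has_derivative_const has_derivative_ident, rule DH)
  have D2: "((\<lambda>q. H (\<phi>0, q, \<pi>1, \<rho>1)) has_derivative (\<lambda>h. H' (0, h, 0, 0))) (at (\<psi>0))"
    by (rule has_derivative_compose[where g = H and g' = H'])
      (intro has_derivative_Pair has_derivative_const has_derivative_ident, rule DH)
  have D3: "((\<lambda>p. H (\<phi>0, \<psi>0, p, \<rho>1)) has_derivative (\<lambda>h. H' (0, 0, h, 0))) (at (\<pi>1))"
    by (rule has_derivative_compose[where g = H and g' = H'])
      (intro has_derivative_Pair has_derivative_const has_derivative_ident, rule DH)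
  have D4: "((\<lambda>p. H (\<phi>0, \<psi>0, \<pi>1, p)) has_derivative (\<lambda>h. H' (0, 0, 0, h))) (at (\<rho>1))"
    by (rule has_derivative_compose[where g = H and g' = H'])
      (intro has_derivative_Pair has_derivative_const has_derivative_ident, rule DH)
  note partial = differentiableI[OF has_derivative_vec_upd_comp[OF D1]]
    differentiableI[OF has_derivative_vec_upd_comp[OF D2]]
    differentiableI[OF has_derivative_vec_upd_comp[OF D3]]
    differentiableI[OF has_derivative_vec_upd_comp[OF D4]]
  note eqs' = eqs[unfolded forward_hamilton_equations_def Let_def, folded \<phi>0_def \<psi>0_def \<phi>1_def
      \<psi>1_def \<pi>0_def \<rho>0_def \<pi>1_def \<rho>1_def]
  have 1: "H' (u, 0, 0, 0) = (\<Sum>i\<in>UNIV. dt * b $ i * blinfun_apply (\<pi>0 $ i) (u $ i))"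
    unfolding derivative_eq_sum_partial[OF D1]
    using eqs' dt b
    by (intro sum.cong) (auto simp: blinfun.scaleR_left
        blinfun_apply_derivative_covector[OF partial(1)])
  have 2: "H' (0, v, 0, 0) = (\<Sum>\<alpha>\<in>UNIV. dx * b' $ \<alpha> * blinfun_apply (\<rho>0 $ \<alpha>) (v $ \<alpha>))"
    unfolding derivative_eq_sum_partial[OF D2]
    using eqs' dx b'
    by (intro sum.cong) (auto simp: blinfun.scaleR_left
        blinfun_apply_derivative_covector[OF partial(2)])
  have 3: "H' (0, 0, w, 0) = (\<Sum>i\<in>UNIV. dt * b $ i * blinfun_apply (w $ i) (\<phi>1 $ i))"
    unfolding derivative_eq_sum_partial[OF D3]
    using eqs' dt b
    by (intro sum.cong) (auto simp: blinfun.scaleR_right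
        blinfun_apply_derivative_vector[OF fin partial(3)])
  have 4: "H' (0, 0, 0, z) = (\<Sum>\<alpha>\<in>UNIV. dx * b' $ \<alpha> * blinfun_apply (z $ \<alpha>) (\<psi>1 $ \<alpha>))"
    unfolding derivative_eq_sum_partial[OF D4]
    using eqs' dx b'
    by (intro sum.cong) (auto simp: blinfun.scaleR_right
        blinfun_apply_derivative_vector[OF fin partial(4)])
  have "H' (u, v, w, z) = H' ((u, 0, 0, 0) + (0, v, 0, 0) + (0, 0, w, 0) + (0, 0, 0, z))"
    by simp
  then show ?thesis
    unfolding H'.add 1 2 3 4 .
qed

lemma has_derivative_boundary_values:
  fixes \<Sigma> :: "'e::real_normed_vector \<Rightarrow> 'q::real_normed_vector bsection"
  assumes "\<And>n. n \<in> X \<Longrightarrow> ((\<lambda>y. \<Sigma> y n) has_derivative (\<lambda>h. D h n)) F"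
  shows "(\<And>i. time_node dt c x i \<in> X) \<Longrightarrow>
      ((\<lambda>y. time_fields dt c (\<Sigma> y) x) has_derivative (\<lambda>h. time_fields dt c (D h) x)) F"
    and "(\<And>i. time_node dt c x i \<in> X) \<Longrightarrow>
      ((\<lambda>y. time_momenta dt c (\<Sigma> y) x) has_derivative (\<lambda>h. time_momenta dt c (D h) x)) F"
    and "(\<And>\<alpha>. space_node dx c' t \<alpha> \<in> X) \<Longrightarrow>
      ((\<lambda>y. space_fields dx c' (\<Sigma> y) t) has_derivative (\<lambda>h. space_fields dx c' (D h) t)) F"
    and "(\<And>\<alpha>. space_node dx c' t \<alpha> \<in> X) \<Longrightarrow>
      ((\<lambda>y. space_momenta dx c' (\<Sigma> y) t) has_derivative (\<lambda>h. space_momenta dx c' (D h) t)) F"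
  unfolding time_fields_def time_momenta_def space_fields_def space_momenta_def
    field_val_def mom0_def mom1_def
  by (intro has_derivative_vec_lambda has_derivative_fst has_derivative_snd assms; simp)+

lemma has_derivative_boundary_pairing:
  fixes P :: "'e::real_normed_vector \<Rightarrow> ('q::real_normed_vector dual)^'n::finite"
  assumes "(P has_derivative P') (at y)" and "(Q has_derivative Q') (at y)"
  shows "((\<lambda>y. \<Sum>i\<in>UNIV. k i * blinfun_apply (P y $ i) (Q y $ i)) has_derivative
      (\<lambda>h. (\<Sum>i\<in>UNIV. k i * blinfun_apply (P y $ i) (Q' h $ i)) +
           (\<Sum>i\<in>UNIV. k i * blinfun_apply (P' h $ i) (Q y $ i)))) (at y)"
proof -
  have "((\<lambda>y. \<Sum>i\<in>UNIV. k i * blinfun_apply (P y $ i) (Q y $ i)) has_derivative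
      (\<lambda>h. \<Sum>i\<in>UNIV. k i * (blinfun_apply (P y $ i) (Q' h $ i) +
                              blinfun_apply (P' h $ i) (Q y $ i)))) (at y)"
    by (intro has_derivative_sum has_derivative_mult_right
        blinfun.FDERIV bounded_linear.has_derivative[OF bounded_linear_vec_nth] assms)
  then show ?thesis
    by (simp add: distrib_left sum.distrib)
qed

lemma chart_at_point:
  assumes "smooth_atlas T A" and "p \<in> topspace T"
  defines "ch \<equiv> SOME ch. ch \<in> charts_at A p"
  shows "ch \<in> A" and "chart_dom ch \<subseteq> topspace T" and "open (chart_img ch)"
    and "chart_map ch p \<in> chart_img ch" and "chart_inv ch (chart_map ch p) = p"
proof -
  obtain ch' where "ch' \<in> A" "p \<in> chart_dom ch'"
    using assms(1,2) unfolding smooth_atlas_def by blast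
  then have "ch' \<in> charts_at A p"
    by (simp add: charts_at_def)
  then have "ch \<in> charts_at A p"
    unfolding ch_def by (rule someI)
  then have ch: "ch \<in> A" "p \<in> chart_dom ch"
    by (auto simp: charts_at_def)
  then have *: "openin T (chart_dom ch)" "open (chart_img ch)"
    "homeomorphic_map (subtopology T (chart_dom ch)) (top_of_set (chart_img ch)) (chart_map ch)"
    using assms(1) unfolding smooth_atlas_def by blast+
  show "ch \<in> A" "open (chart_img ch)" "chart_map ch p \<in> chart_img ch"
    using ch * by auto
  show dom: "chart_dom ch \<subseteq> topspace T"
    using *(1) by (rule openin_subset)
  then have "inj_on (chart_map ch) (chart_dom ch)"
    using homeomorphic_imp_injective_map[OF *(3)] by (simp add: inf.absorb2)
  then show "chart_inv ch (chart_map ch p) = p"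
    using ch(2) by (rule inv_into_f_f)
qed

theorem proposition2p4:
  fixes dt dx :: real
    and c b :: "real^'s::finite"
    and c' b' :: "real^'r::finite"
    and X :: "node set"
    and H :: "('q::real_normed_vector, 's, 'r) bhamiltonian"
    and G :: "('g, 'z) monoid_scheme"
    and T :: "'g topology"
    and A :: "('g, 'e::real_normed_vector) chart set"
    and \<Phi> :: "('g, 'q) baction"
    and \<sigma> :: "'q bsection"
    and \<xi> :: "('g, 'e) chart \<Rightarrow> 'e"
  assumes "\<exists>B::'q set. finite B \<and> span B = UNIV"
    and "0 < dt" and "0 < dx"
    and "quadrature_rule c b" and "quadrature_rule c' b'"
    and "admissible_nodes dt dx c c' X"
    and "smooth_on UNIV H"
    and "lie_group G T A"
    and "group_action G (X \<times> UNIV) \<Phi>"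
    and "vertical_action G X \<Phi>"
    and "differentiable_action A X \<Phi>"
    and "invariant_under G \<Phi> (section_lagrangian dt dx c b c' b' H)"
    and "forward_hamilton_equations dt dx c b c' b' H \<sigma>"
    and "\<xi> \<in> lie_algebra G A"
  shows "let \<delta> = infinitesimal_generator G A \<Phi> \<xi> \<sigma> in
      (\<Sum>i\<in>UNIV. dt * b $ i *
         blinfun_apply (time_momenta dt c \<sigma> dx $ i) (time_fields dt c \<delta> dx $ i)) +
      (\<Sum>\<alpha>\<in>UNIV. dx * b' $ \<alpha> *
         blinfun_apply (space_momenta dx c' \<sigma> dt $ \<alpha>) (space_fields dx c' \<delta> dt $ \<alpha>)) -
      (\<Sum>i\<in>UNIV. dt * b $ i *
         blinfun_apply (time_momenta dt c \<sigma> 0 $ i) (time_fields dt c \<delta> 0 $ i)) -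
      (\<Sum>\<alpha>\<in>UNIV. dx * b' $ \<alpha> *
         blinfun_apply (space_momenta dx c' \<sigma> 0 $ \<alpha>) (space_fields dx c' \<delta> 0 $ \<alpha>)) = 0"
proof -
  interpret lie_group G T A by fact
  interpret group_action G "X \<times> UNIV" \<Phi> by fact
  define ch where "ch = (SOME ch. ch \<in> charts_at A \<one>\<^bsub>G\<^esub>)"
  define y0 where "y0 = chart_map ch \<one>\<^bsub>G\<^esub>"
  define \<Sigma> where "\<Sigma> y = section_action \<Phi> (chart_inv ch y) \<sigma>" for y
  define D where "D h n = frechet_derivative (\<lambda>y. \<Sigma> y n) (at y0) h" for h n
  have "\<one>\<^bsub>G\<^esub> \<in> topspace T"
    by (simp add: topspace_carrier)
  note ch = chart_at_point[OF atlas this, folded ch_def, folded y0_def]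

  have \<Sigma>_y0: "\<Sigma> y0 n = \<sigma> n" if "n \<in> X" for n
  proof -
    have "\<Phi> \<one>\<^bsub>G\<^esub> (n, \<sigma> n) = (n, \<sigma> n)"
      using that by (metis id_eq_one restrict_apply' mem_Sigma_iff UNIV_I)
    then show ?thesis
      by (simp add: \<Sigma>_def section_action_def ch(5))
  qed

  have D: "((\<lambda>y. \<Sigma> y n) has_derivative (\<lambda>h. D h n)) (at y0)" if "n \<in> X" for n
  proof -
    have "(\<lambda>(y, v). snd (\<Phi> (chart_inv ch y) (n, v))) differentiable_on (chart_img ch \<times> UNIV)"
      using assms(11) that ch(1) unfolding differentiable_action_def by blast
    moreover have "open (chart_img ch \<times> (UNIV :: 'q fiber set))"
      using ch(3) by (intro open_Times) auto
    ultimately have "(\<lambda>(y, v). snd (\<Phi> (chart_inv ch y) (n, v))) differentiable (at (y0, \<sigma> n))"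
      using ch(4) by (metis differentiable_on_eq_differentiable_at mem_Sigma_iff UNIV_I)
    then obtain F' where
      "((\<lambda>(y, v). snd (\<Phi> (chart_inv ch y) (n, v))) has_derivative F') (at (y0, \<sigma> n))"
      unfolding differentiable_def by blast
    from has_derivative_compose[of "\<lambda>y. (y, \<sigma> n)" "\<lambda>h. (h, 0)" y0 UNIV, OF _ this]
    have "((\<lambda>y. \<Sigma> y n) has_derivative (\<lambda>h. F' (h, 0))) (at y0)"
      by (simp add: \<Sigma>_def section_action_def has_derivative_Pair)
    then show ?thesis
      unfolding D_def by (metis frechet_derivative_works differentiableI)
  qed

  have generator: "infinitesimal_generator G A \<Phi> \<xi> \<sigma> = D (\<xi> ch)"
    by (simp add: infinitesimal_generator_def tangent_map_def D_def \<Sigma>_def y0_def comp_def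
        fun_eq_iff flip: ch_def)

  have nodes: "time_node dt c 0 i \<in> X" "time_node dt c dx i \<in> X"
    "space_node dx c' 0 \<alpha> \<in> X" "space_node dx c' dt \<alpha> \<in> X" for i \<alpha>
    using assms(6) unfolding admissible_nodes_def by auto
  have boundary_y0: "time_fields dt c (\<Sigma> y0) 0 = time_fields dt c \<sigma> 0"
    "time_fields dt c (\<Sigma> y0) dx = time_fields dt c \<sigma> dx"
    "time_momenta dt c (\<Sigma> y0) dx = time_momenta dt c \<sigma> dx"
    "space_fields dx c' (\<Sigma> y0) 0 = space_fields dx c' \<sigma> 0"
    "space_fields dx c' (\<Sigma> y0) dt = space_fields dx c' \<sigma> dt"
    "space_momenta dx c' (\<Sigma> y0) dt = space_momenta dx c' \<sigma> dt"
    by (simp_all add: time_fields_def time_momenta_def space_fields_def space_momenta_def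
        \<Sigma>_y0 nodes)
  note D_boundary = has_derivative_boundary_values[where X = X and F = "at y0", OF D]

  have "k_times_differentiable_on (Suc 0) UNIV H"
    using assms(7) unfolding smooth_on_def by blast
  then obtain H' where H': "(H has_derivative H') (at (time_fields dt c \<sigma> 0,
      space_fields dx c' \<sigma> 0, time_momenta dt c \<sigma> dx, space_momenta dx c' \<sigma> dt))"
    unfolding k_times_differentiable_on.simps differentiable_def by blast
  have "((\<lambda>y. H (time_fields dt c (\<Sigma> y) 0, space_fields dx c' (\<Sigma> y) 0,
        time_momenta dt c (\<Sigma> y) dx, space_momenta dx c' (\<Sigma> y) dt)) has_derivative
      (\<lambda>h. H' (time_fields dt c (D h) 0, space_fields dx c' (D h) 0,
        time_momenta dt c (D h) dx, space_momenta dx c' (D h) dt))) (at y0)"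
    by (rule has_derivative_compose[where g = H])
      (intro has_derivative_Pair D_boundary nodes, simp_all add: boundary_y0 H')
  moreover have "((\<lambda>y. section_lagrangian dt dx c b c' b' H (\<Sigma> y)) has_derivative (\<lambda>_. 0)) (at y0)"
  proof (rule has_derivative_transform_within_open[OF has_derivative_const ch(3,4)])
    fix y assume "y \<in> chart_img ch"
    then have "chart_inv ch y \<in> carrier G"
      using ch(2) inv_into_into[of y "chart_map ch" "chart_dom ch"] topspace_carrier by blast
    then show "section_lagrangian dt dx c b c' b' H \<sigma> =
        section_lagrangian dt dx c b c' b' H (\<Sigma> y)"
      using assms(12) unfolding invariant_under_def \<Sigma>_def by simp
  qed
  ultimately have "(\<lambda>h.
      ((\<Sum>i\<in>UNIV. dt * b $ i *
          blinfun_apply (time_momenta dt c (\<Sigma> y0) dx $ i) (time_fields dt c (D h) dx $ i)) +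
       (\<Sum>i\<in>UNIV. dt * b $ i *
          blinfun_apply (time_momenta dt c (D h) dx $ i) (time_fields dt c (\<Sigma> y0) dx $ i))) +
      ((\<Sum>\<alpha>\<in>UNIV. dx * b' $ \<alpha> *
          blinfun_apply (space_momenta dx c' (\<Sigma> y0) dt $ \<alpha>) (space_fields dx c' (D h) dt $ \<alpha>)) +
       (\<Sum>\<alpha>\<in>UNIV. dx * b' $ \<alpha> *
          blinfun_apply (space_momenta dx c' (D h) dt $ \<alpha>) (space_fields dx c' (\<Sigma> y0) dt $ \<alpha>))) -
      H' (time_fields dt c (D h) 0, space_fields dx c' (D h) 0,
        time_momenta dt c (D h) dx, space_momenta dx c' (D h) dt)) = (\<lambda>_. 0)"
    unfolding section_lagrangian_def generalized_lagrangian_def prod.case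
    by (intro has_derivative_unique[rotated])
      (assumption, intro has_derivative_diff has_derivative_add has_derivative_boundary_pairing
        D_boundary nodes)
  from fun_cong[OF this, of "\<xi> ch"] show ?thesis
    using assms(2-5)
    unfolding Let_def generator boundary_y0
    by (subst (asm) derivative_boundary_hamiltonian[OF assms(1) _ _ _ _ assms(13) H'])
      (auto simp: quadrature_rule_def)
qed

end
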